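(* Let $R$ be a commutative semiring and $v:R\to M$ a strong valuation. The tangible strong supervaluation $\chi:R\to U$ covering $v$ that is defined in the context dominates every very strong supervaluation covering $v$, and hence (its class) is the top element of both $\mathrm{Cov}_{s}^*(v)$ and $\mathrm{Cov}_{t,s}(v)$.
   Context: All semirings are commutative with $0$ and $1$. A semiring $M$ is bipotent if $a+b\in\{a,b\}$ for all $a,b\in M$; it is totally ordered by $a\le b\iff a+b=b$. A valuation on $R$ is a map $v:R\to M$ into a bipotent semiring $M\neq\{0\}$ such that $M\setminus\{0\}$ is closed under multiplication and is a cancellative monoid, with $v(0)=0$, $v(1)=1$, $v(xy)=v(x)v(y)$, $v(x+y)\le v(x)+v(y)$. It is strong if $v(a+b)=\max(v(a),v(b))$ whenever $v(a)\ne v(b)$ (same definition for m-valuations, where $M$ is any bipotent semiring $\neq\{0\}$). A supertropical semiring is a semiring $U$ such that, with $e=e_U:=1+1$: (1) $1+1=1+1+1+1$; (2) $a+a=b+b$ implies $a+b=a+a$; (3) $a+a\ne b+b$ implies $a+b\in\{a,b\}$. Then $eU$ is a bipotent semiring with unit element $e$; $\mathcal T(U):=U\setminus eU$. A supervaluation on $R$ is a map $\varphi:R\to U$ into a supertropical semiring with $\varphi(0)=0$, $\varphi(1)=1$, $\varphi(ab)=\varphi(a)\varphi(b)$ and $e\varphi(a+b)\le e\varphi(a)+e\varphi(b)$. It covers $v:R\to M$ if $eU=M$ and $e\varphi(a)=v(a)$ for all $a$. It is tangible if $\varphi(R)\subset\mathcal T(U)\cup\{0\}$; tangibly additive if $\varphi(a)+\varphi(b)\in\mathcal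 T(U)$ implies $\varphi(a)+\varphi(b)=\varphi(a+b)$; strong if it is tangibly additive and $e\varphi$ is strong; very strong if $e\varphi(a)<e\varphi(b)$ implies $\varphi(a+b)=\varphi(b)$, for all $a,b\in R$. $\varphi:R\to U$ dominates $\psi:R\to V$ if for all $a,b\in R$: (D1) $\varphi(a)=\varphi(b)\Rightarrow\psi(a)=\psi(b)$; (D2) $e\varphi(a)\le e\varphi(b)\Rightarrow e\psi(a)\le e\psi(b)$; (D3) $\varphi(a)\in eU\Rightarrow\psi(a)\in eV$. Two covers of $v$ are equivalent if each dominates the other; $\mathrm{Cov}(v)$ is the set of equivalence classes of supervaluations covering $v$, ordered by dominance (no distinction is made between a cover and its class). $\mathrm{Cov}_s^*(v)$ is the subset of very strong supervaluations in $\mathrm{Cov}(v)$, and $\mathrm{Cov}_{t,s}(v)$ the subset of those that are both tangible and strong. Definition of $\chi$: let $\mathfrak q=v^{-1}(0)$. Define an equivalence relation on $R$ by: $a_1\sim_v a_2$ iff either $v(a_1)=v(a_2)=0$, or there are $c_1,c_2\in R$ with $v(c_1)<v(a_1)$, $v(c_2)<v(a_2)$, $a_1+c_1=a_2+c_2$. It is compatible with multiplication, and $a_1\sim_va_2$ implies $v(a_1)=v(a_2)$. Write $[a]_v$ for classes and $\overline{R\setminus\mathfrak q}$ for the monoid of classes of elements of $R\setminus\mathfrak q$. Let $U=\overline{R\setminus\mathfrak q}\,\dot\cup\,M$ with multiplication extending those of $\overline{R\setminus\mathfrak q}$ and $M$ and $[a]_v\cdot x=x\cdot[a]_v=v(a)x$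 for $x\in M$. Put $e[a]_v=v(a)$ and $ex=x$ for $x\in M$; addition is $x+y=x$ if $ex>ey$, $x+y=y$ if $ex<ey$, $x+y=ex$ if $ex=ey$. Then $U$ is a supertropical semiring with $eU=M$, $\mathcal T(U)=\overline{R\setminus\mathfrak q}$. The map $\chi:R\to U$ is $\chi(a)=0$ for $a\in\mathfrak q$ and $\chi(a)=[a]_v$ for $a\notin\mathfrak q$; it is a tangible strong supervaluation covering $v$. *)

theory Defs
  imports "HOL-Algebra.Algebra"
begin

locale csemiring = semiring R + comm_monoid R for R (structure)

locale bipotent_semiring = csemiring M for M (structure) +
  assumes bipotent: "\<lbrakk>a \<in> carrier M; b \<in> carrier M\<rbrakk> \<Longrightarrow> a \<oplus> b \<in> {a, b}"

definition bip_le :: "('m, 'x) ring_scheme \<Rightarrow> 'm \<Rightarrow> 'm \<Rightarrow> bool" where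
  "bip_le M a b \<longleftrightarrow> a \<oplus>\<^bsub>M\<^esub> b = b"

definition bip_less :: "('m, 'x) ring_scheme \<Rightarrow> 'm \<Rightarrow> 'm \<Rightarrow> bool" where
  "bip_less M a b \<longleftrightarrow> bip_le M a b \<and> a \<noteq> b"

definition bip_max :: "('m, 'x) ring_scheme \<Rightarrow> 'm \<Rightarrow> 'm \<Rightarrow> 'm" where
  "bip_max M a b = (if bip_le M a b then b else a)"


section \<open>Valuations\<close>

locale valuation = R: csemiring R + M: bipotent_semiring M
  for R :: "('r, 'x) ring_scheme" and M :: "('m, 'y) ring_scheme" and v :: "'r \<Rightarrow> 'm" +
  assumes nontrivial: "carrier M \<noteq> {\<zero>\<^bsub>M\<^esub>}"
    and cancellative: "comm_monoid_cancel (M\<lparr>carrier := carrier M - {\<zero>\<^bsub>M\<^esub>}\<rparr>)"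
    and v_closed: "v \<in> carrier R \<rightarrow> carrier M"
    and v_zero: "v \<zero>\<^bsub>R\<^esub> = \<zero>\<^bsub>M\<^esub>"
    and v_one: "v \<one>\<^bsub>R\<^esub> = \<one>\<^bsub>M\<^esub>"
    and v_mult: "\<lbrakk>a \<in> carrier R; b \<in> carrier R\<rbrakk> \<Longrightarrow> v (a \<otimes>\<^bsub>R\<^esub> b) = v a \<otimes>\<^bsub>M\<^esub> v b"
    and v_add: "\<lbrakk>a \<in> carrier R; b \<in> carrier R\<rbrakk>
      \<Longrightarrow> bip_le M (v (a \<oplus>\<^bsub>R\<^esub> b)) (v a \<oplus>\<^bsub>M\<^esub> v b)"

definition strong_map ::
  "('r, 'x) ring_scheme \<Rightarrow> ('m, 'y) ring_scheme \<Rightarrow> ('r \<Rightarrow> 'm) \<Rightarrow> bool" where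
  "strong_map R M v \<longleftrightarrow> (\<forall>a\<in>carrier R. \<forall>b\<in>carrier R.
     v a \<noteq> v b \<longrightarrow> v (a \<oplus>\<^bsub>R\<^esub> b) = bip_max M (v a) (v b))"

definition strong_valuation ::
  "('r, 'x) ring_scheme \<Rightarrow> ('m, 'y) ring_scheme \<Rightarrow> ('r \<Rightarrow> 'm) \<Rightarrow> bool" where
  "strong_valuation R M v \<longleftrightarrow> valuation R M v \<and> strong_map R M v"


section \<open>Supertropical semirings and supervaluations\<close>

locale supertropical = csemiring U for U (structure) +
  assumes one_plus_one: "\<one> \<oplus> \<one> = \<one> \<oplus> \<one> \<oplus> \<one> \<oplus> \<one>"
    and add_ghost:
      "\<lbrakk>a \<in> carrier U; b \<in> carrier U; a \<oplus> a = b \<oplus> b\<rbrakk> \<Longrightarrow> a \<oplus> b = a \<oplus> a"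
    and add_select:
      "\<lbrakk>a \<in> carrier U; b \<in> carrier U; a \<oplus> a \<noteq> b \<oplus> b\<rbrakk> \<Longrightarrow> a \<oplus> b \<in> {a, b}"

definition ghost_unit :: "('u, 'x) ring_scheme \<Rightarrow> 'u" where
  "ghost_unit U = \<one>\<^bsub>U\<^esub> \<oplus>\<^bsub>U\<^esub> \<one>\<^bsub>U\<^esub>"

text \<open>\<open>ghosts U\<close> is the bipotent semiring \<open>eU\<close>, whose unit element is \<open>e\<close>.\<close>

definition ghosts :: "('u, 'x) ring_scheme \<Rightarrow> ('u, 'x) ring_scheme" where
  "ghosts U = U\<lparr>carrier := (\<lambda>x. ghost_unit U \<otimes>\<^bsub>U\<^esub> x) ` carrier U, one := ghost_unit U\<rparr>"

definition tangibles :: "('u, 'x) ring_scheme \<Rightarrow> 'u set" where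
  "tangibles U = carrier U - carrier (ghosts U)"

definition ghost_of ::
  "('u, 'x) ring_scheme \<Rightarrow> ('r \<Rightarrow> 'u) \<Rightarrow> 'r \<Rightarrow> 'u" where
  "ghost_of U \<phi> a = ghost_unit U \<otimes>\<^bsub>U\<^esub> \<phi> a"

locale supervaluation = R: csemiring R + U: supertropical U
  for R :: "('r, 'x) ring_scheme" and U :: "('u, 'y) ring_scheme" and \<phi> :: "'r \<Rightarrow> 'u" +
  assumes closed: "\<phi> \<in> carrier R \<rightarrow> carrier U"
    and map_zero: "\<phi> \<zero>\<^bsub>R\<^esub> = \<zero>\<^bsub>U\<^esub>"
    and map_one: "\<phi> \<one>\<^bsub>R\<^esub> = \<one>\<^bsub>U\<^esub>"
    and map_mult:
      "\<lbrakk>a \<in> carrier R; b \<in> carrier R\<rbrakk> \<Longrightarrow> \<phi> (a \<otimes>\<^bsub>R\<^esub> b) = \<phi> a \<otimes>\<^bsub>U\<^esub> \<phi> b"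
    and map_add: "\<lbrakk>a \<in> carrier R; b \<in> carrier R\<rbrakk> \<Longrightarrow>
      bip_le (ghosts U) (ghost_of U \<phi> (a \<oplus>\<^bsub>R\<^esub> b)) (ghost_of U \<phi> a \<oplus>\<^bsub>U\<^esub> ghost_of U \<phi> b)"

text \<open>
  The identification \<open>eU = M\<close> is made by a semiring isomorphism \<open>\<iota>\<close> from \<open>M\<close> onto \<open>eU\<close>, since
  \<open>M\<close> and \<open>U\<close> live on different types. None of the notions below depends on the choice of \<open>\<iota>\<close>.
\<close>

definition covers ::
  "('r, 'x) ring_scheme \<Rightarrow> ('m, 'y) ring_scheme \<Rightarrow> ('r \<Rightarrow> 'm)
    \<Rightarrow> ('u, 'z) ring_scheme \<Rightarrow> ('r \<Rightarrow> 'u) \<Rightarrow> bool" where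
  "covers R M v U \<phi> \<longleftrightarrow> supervaluation R U \<phi> \<and>
     (\<exists>\<iota>\<in>ring_iso M (ghosts U). \<forall>a\<in>carrier R. ghost_of U \<phi> a = \<iota> (v a))"

definition tangible ::
  "('r, 'x) ring_scheme \<Rightarrow> ('u, 'y) ring_scheme \<Rightarrow> ('r \<Rightarrow> 'u) \<Rightarrow> bool" where
  "tangible R U \<phi> \<longleftrightarrow> \<phi> ` carrier R \<subseteq> tangibles U \<union> {\<zero>\<^bsub>U\<^esub>}"

definition tangibly_additive ::
  "('r, 'x) ring_scheme \<Rightarrow> ('u, 'y) ring_scheme \<Rightarrow> ('r \<Rightarrow> 'u) \<Rightarrow> bool" where
  "tangibly_additive R U \<phi> \<longleftrightarrow> (\<forall>a\<in>carrier R. \<forall>b\<in>carrier R.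
     \<phi> a \<oplus>\<^bsub>U\<^esub> \<phi> b \<in> tangibles U \<longrightarrow> \<phi> a \<oplus>\<^bsub>U\<^esub> \<phi> b = \<phi> (a \<oplus>\<^bsub>R\<^esub> b))"

definition strong ::
  "('r, 'x) ring_scheme \<Rightarrow> ('u, 'y) ring_scheme \<Rightarrow> ('r \<Rightarrow> 'u) \<Rightarrow> bool" where
  "strong R U \<phi> \<longleftrightarrow> tangibly_additive R U \<phi> \<and> strong_map R (ghosts U) (ghost_of U \<phi>)"

definition very_strong ::
  "('r, 'x) ring_scheme \<Rightarrow> ('u, 'y) ring_scheme \<Rightarrow> ('r \<Rightarrow> 'u) \<Rightarrow> bool" where
  "very_strong R U \<phi> \<longleftrightarrow> (\<forall>a\<in>carrier R. \<forall>b\<in>carrier R.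
     bip_less (ghosts U) (ghost_of U \<phi> a) (ghost_of U \<phi> b) \<longrightarrow> \<phi> (a \<oplus>\<^bsub>R\<^esub> b) = \<phi> b)"


section \<open>Dominance and the poset of covers\<close>

definition dominates ::
  "('r, 'x) ring_scheme \<Rightarrow> ('u, 'y) ring_scheme \<Rightarrow> ('r \<Rightarrow> 'u)
    \<Rightarrow> ('w, 'z) ring_scheme \<Rightarrow> ('r \<Rightarrow> 'w) \<Rightarrow> bool" where
  "dominates R U \<phi> V \<psi> \<longleftrightarrow> (\<forall>a\<in>carrier R. \<forall>b\<in>carrier R.
     (\<phi> a = \<phi> b \<longrightarrow> \<psi> a = \<psi> b) \<and>
     (bip_le (ghosts U) (ghost_of U \<phi> a) (ghost_of U \<phi> b)
        \<longrightarrow> bip_le (ghosts V) (ghost_of V \<psi> a) (ghost_of V \<psi> b)) \<and>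
     (\<phi> a \<in> carrier (ghosts U) \<longrightarrow> \<psi> a \<in> carrier (ghosts V)))"

text \<open>
  The covers of \<open>v\<close> form a proper class. They are collected on the fixed type \<open>'r set + 'm\<close>, which
  contains the target of \<open>\<chi>\<close> and loses nothing: by the lemma \<open>covers_small\<close> below, a cover with target
  on any type is equivalent to one with target on this type.
\<close>

definition Covers ::
  "('r, 'x) ring_scheme \<Rightarrow> ('m, 'y) ring_scheme \<Rightarrow> ('r \<Rightarrow> 'm)
    \<Rightarrow> (('r set + 'm) ring \<times> ('r \<Rightarrow> 'r set + 'm)) set" where
  "Covers R M v = {(U, \<phi>). covers R M v U \<phi>}"

definition cover_equiv ::
  "('r, 'x) ring_scheme \<Rightarrow> ('m, 'y) ring_scheme \<Rightarrow> ('r \<Rightarrow> 'm)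
    \<Rightarrow> (('r set + 'm) ring \<times> ('r \<Rightarrow> 'r set + 'm)) rel" where
  "cover_equiv R M v = {((U, \<phi>), (V, \<psi>)). (U, \<phi>) \<in> Covers R M v \<and> (V, \<psi>) \<in> Covers R M v \<and>
     dominates R U \<phi> V \<psi> \<and> dominates R V \<psi> U \<phi>}"

definition cover_class ::
  "('r, 'x) ring_scheme \<Rightarrow> ('m, 'y) ring_scheme \<Rightarrow> ('r \<Rightarrow> 'm)
    \<Rightarrow> ('r set + 'm) ring \<Rightarrow> ('r \<Rightarrow> 'r set + 'm)
    \<Rightarrow> (('r set + 'm) ring \<times> ('r \<Rightarrow> 'r set + 'm)) set" where
  "cover_class R M v U \<phi> = cover_equiv R M v `` {(U, \<phi>)}"

definition class_le ::
  "('r, 'x) ring_scheme \<Rightarrow> (('r set + 'm) ring \<times> ('r \<Rightarrow> 'r set + 'm)) set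
    \<Rightarrow> (('r set + 'm) ring \<times> ('r \<Rightarrow> 'r set + 'm)) set \<Rightarrow> bool" where
  "class_le R C D \<longleftrightarrow> (\<forall>(V, \<psi>)\<in>C. \<forall>(U, \<phi>)\<in>D. dominates R U \<phi> V \<psi>)"

definition Cov ::
  "('r, 'x) ring_scheme \<Rightarrow> ('m, 'y) ring_scheme \<Rightarrow> ('r \<Rightarrow> 'm)
    \<Rightarrow> (('r set + 'm) ring \<times> ('r \<Rightarrow> 'r set + 'm)) set gorder" where
  "Cov R M v = \<lparr>carrier = Covers R M v // cover_equiv R M v, eq = (=), le = class_le R\<rparr>"

definition Cov_very_strong ::
  "('r, 'x) ring_scheme \<Rightarrow> ('m, 'y) ring_scheme \<Rightarrow> ('r \<Rightarrow> 'm)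
    \<Rightarrow> (('r set + 'm) ring \<times> ('r \<Rightarrow> 'r set + 'm)) set set" where
  "Cov_very_strong R M v =
     {C \<in> carrier (Cov R M v). \<exists>(U, \<phi>)\<in>C. very_strong R U \<phi>}"

definition Cov_tangible_strong ::
  "('r, 'x) ring_scheme \<Rightarrow> ('m, 'y) ring_scheme \<Rightarrow> ('r \<Rightarrow> 'm)
    \<Rightarrow> (('r set + 'm) ring \<times> ('r \<Rightarrow> 'r set + 'm)) set set" where
  "Cov_tangible_strong R M v =
     {C \<in> carrier (Cov R M v). \<exists>(U, \<phi>)\<in>C. tangible R U \<phi> \<and> strong R U \<phi>}"


section \<open>The supervaluation \<open>\<chi>\<close>\<close>

definition val_rel ::
  "('r, 'x) ring_scheme \<Rightarrow> ('m, 'y) ring_scheme \<Rightarrow> ('r \<Rightarrow> 'm) \<Rightarrow> 'r rel" where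
  "val_rel R M v = {(a1, a2). a1 \<in> carrier R \<and> a2 \<in> carrier R \<and>
     ((v a1 = \<zero>\<^bsub>M\<^esub> \<and> v a2 = \<zero>\<^bsub>M\<^esub>) \<or>
      (\<exists>c1\<in>carrier R. \<exists>c2\<in>carrier R.
         bip_less M (v c1) (v a1) \<and> bip_less M (v c2) (v a2) \<and>
         a1 \<oplus>\<^bsub>R\<^esub> c1 = a2 \<oplus>\<^bsub>R\<^esub> c2))}"

definition val_kernel ::
  "('r, 'x) ring_scheme \<Rightarrow> ('m, 'y) ring_scheme \<Rightarrow> ('r \<Rightarrow> 'm) \<Rightarrow> 'r set" where
  "val_kernel R M v = {a \<in> carrier R. v a = \<zero>\<^bsub>M\<^esub>}"

text \<open>
  In the disjoint union, \<open>Inl C\<close> is a class of elements of \<open>R\<close> and \<open>Inr x\<close> an element of \<open>M\<close>.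
  \<open>chi_ghost\<close> is \<open>x \<mapsto> ex\<close> with values in \<open>M\<close>; \<open>v\<close> is constant on each class.
\<close>

fun chi_ghost :: "('r \<Rightarrow> 'm) \<Rightarrow> 'r set + 'm \<Rightarrow> 'm" where
  "chi_ghost v (Inl C) = the_elem (v ` C)"
| "chi_ghost v (Inr x) = x"

fun chi_mult ::
  "('r, 'x) ring_scheme \<Rightarrow> ('m, 'y) ring_scheme \<Rightarrow> ('r \<Rightarrow> 'm)
    \<Rightarrow> 'r set + 'm \<Rightarrow> 'r set + 'm \<Rightarrow> 'r set + 'm" where
  "chi_mult R M v (Inl C) (Inl D) = Inl (\<Union>a\<in>C. \<Union>b\<in>D. val_rel R M v `` {a \<otimes>\<^bsub>R\<^esub> b})"
| "chi_mult R M v x y = Inr (chi_ghost v x \<otimes>\<^bsub>M\<^esub> chi_ghost v y)"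

definition chi_add ::
  "('m, 'y) ring_scheme \<Rightarrow> ('r \<Rightarrow> 'm) \<Rightarrow> 'r set + 'm \<Rightarrow> 'r set + 'm \<Rightarrow> 'r set + 'm" where
  "chi_add M v x y =
     (if bip_less M (chi_ghost v y) (chi_ghost v x) then x
      else if bip_less M (chi_ghost v x) (chi_ghost v y) then y
      else Inr (chi_ghost v x))"

definition chi_semiring ::
  "('r, 'x) ring_scheme \<Rightarrow> ('m, 'y) ring_scheme \<Rightarrow> ('r \<Rightarrow> 'm) \<Rightarrow> ('r set + 'm) ring" where
  "chi_semiring R M v =
     \<lparr>carrier = ((carrier R - val_kernel R M v) // val_rel R M v) <+> carrier M,
      monoid.mult = chi_mult R M v,
      one = Inl (val_rel R M v `` {\<one>\<^bsub>R\<^esub>}),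
      ring.zero = Inr \<zero>\<^bsub>M\<^esub>,
      ring.add = chi_add M v\<rparr>"

definition chi ::
  "('r, 'x) ring_scheme \<Rightarrow> ('m, 'y) ring_scheme \<Rightarrow> ('r \<Rightarrow> 'm) \<Rightarrow> 'r \<Rightarrow> 'r set + 'm" where
  "chi R M v a =
     (if a \<in> val_kernel R M v then Inr \<zero>\<^bsub>M\<^esub> else Inl (val_rel R M v `` {a}))"


section \<open>The type bound in \<open>Covers\<close> is harmless\<close>

lemma dominates_trans:
  "\<lbrakk>dominates R U \<phi> V \<psi>; dominates R V \<psi> W \<theta>\<rbrakk> \<Longrightarrow> dominates R U \<phi> W \<theta>"
  unfolding dominates_def by blast

lemma equiv_cover_equiv: "equiv (Covers R M v) (cover_equiv R M v)"
proof (rule equivI)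
  show "cover_equiv R M v \<subseteq> Covers R M v \<times> Covers R M v"
    unfolding cover_equiv_def by auto
  show "refl_on (Covers R M v) (cover_equiv R M v)"
    unfolding refl_on_def cover_equiv_def dominates_def by auto
  show "sym (cover_equiv R M v)"
    unfolding sym_def cover_equiv_def by auto
  show "trans (cover_equiv R M v)"
    unfolding trans_def cover_equiv_def by (auto intro: dominates_trans)
qed

lemma class_le_class_iff:
  assumes "(V, \<psi>) \<in> Covers R M v" "(U, \<phi>) \<in> Covers R M v"
  shows "class_le R (cover_class R M v V \<psi>) (cover_class R M v U \<phi>) \<longleftrightarrow> dominates R U \<phi> V \<psi>"
proof
  have "(V, \<psi>) \<in> cover_class R M v V \<psi>" "(U, \<phi>) \<in> cover_class R M v U \<phi>"
    using assms equiv_class_self[OF equiv_cover_equiv] unfolding cover_class_def by blast+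
  then show "class_le R (cover_class R M v V \<psi>) (cover_class R M v U \<phi>) \<Longrightarrow> dominates R U \<phi> V \<psi>"
    unfolding class_le_def by blast
  show "dominates R U \<phi> V \<psi> \<Longrightarrow> class_le R (cover_class R M v V \<psi>) (cover_class R M v U \<phi>)"
    unfolding class_le_def cover_class_def cover_equiv_def
    by (auto intro: dominates_trans)
qed

lemma partial_order_Cov: "partial_order (Cov R M v)"
proof -
  have rep: "\<exists>U \<phi>. (U, \<phi>) \<in> Covers R M v \<and> C = cover_class R M v U \<phi>"
    if "C \<in> Covers R M v // cover_equiv R M v" for C
    using that unfolding quotient_def cover_class_def by auto
  show ?thesis
  proof (unfold_locales, simp_all add: Cov_def)
    fix C D E
    assume C: "C \<in> Covers R M v // cover_equiv R M v"
    then obtain U \<phi> where U: "(U, \<phi>) \<in> Covers R M v" "C = cover_class R M v U \<phi>"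
      using rep by blast
    show "class_le R C C"
      unfolding U(2) class_le_class_iff[OF U(1) U(1)] by (simp add: dominates_def)
    assume D: "D \<in> Covers R M v // cover_equiv R M v"
    then obtain V \<psi> where V: "(V, \<psi>) \<in> Covers R M v" "D = cover_class R M v V \<psi>"
      using rep by blast
    show "C = D" if "class_le R C D" "class_le R D C"
    proof -
      have "((U, \<phi>), (V, \<psi>)) \<in> cover_equiv R M v"
        using that unfolding U(2) V(2) class_le_class_iff[OF U(1) V(1)]
          class_le_class_iff[OF V(1) U(1)] cover_equiv_def using U(1) V(1) by simp
      then show ?thesis
        unfolding U(2) V(2) cover_class_def by (rule equiv_class_eq[OF equiv_cover_equiv])
    qed
    assume E: "E \<in> Covers R M v // cover_equiv R M v"
    then obtain W \<theta> where W: "(W, \<theta>) \<in> Covers R M v" "E = cover_class R M v W \<theta>"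
      using rep by blast
    show "class_le R C E" if "class_le R C D" "class_le R D E"
      using that unfolding U(2) V(2) W(2) class_le_class_iff[OF U(1) V(1)]
        class_le_class_iff[OF V(1) W(1)] class_le_class_iff[OF U(1) W(1)]
      by (metis dominates_trans)
  qed
qed

lemma supertropical_image:
  fixes V :: "('u, 'y) ring_scheme" and U :: "('w, 'z) ring_scheme"
  assumes V: "supertropical V" and W: "W \<subseteq> carrier V"
    and ops: "\<zero>\<^bsub>V\<^esub> \<in> W" "\<one>\<^bsub>V\<^esub> \<in> W"
      "\<And>x y. \<lbrakk>x \<in> W; y \<in> W\<rbrakk> \<Longrightarrow> x \<oplus>\<^bsub>V\<^esub> y \<in> W" "\<And>x y. \<lbrakk>x \<in> W; y \<in> W\<rbrakk> \<Longrightarrow> x \<otimes>\<^bsub>V\<^esub> y \<in> W"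
    and inj: "inj_on j W" and U: "carrier U = j ` W" "\<zero>\<^bsub>U\<^esub> = j \<zero>\<^bsub>V\<^esub>" "\<one>\<^bsub>U\<^esub> = j \<one>\<^bsub>V\<^esub>"
      "\<And>x y. \<lbrakk>x \<in> W; y \<in> W\<rbrakk> \<Longrightarrow> j x \<oplus>\<^bsub>U\<^esub> j y = j (x \<oplus>\<^bsub>V\<^esub> y)"
      "\<And>x y. \<lbrakk>x \<in> W; y \<in> W\<rbrakk> \<Longrightarrow> j x \<otimes>\<^bsub>U\<^esub> j y = j (x \<otimes>\<^bsub>V\<^esub> y)"
  shows "supertropical U"
proof -
  interpret V: supertropical V by (rule V)
  have W': "x \<in> carrier V" if "x \<in> W" for x using that W by blast
  have jeq: "j x = j y \<longleftrightarrow> x = y" if "x \<in> W" "y \<in> W" for x y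
    using that inj by (auto simp: inj_on_def)
  note [simp] = U ops jeq W'
  have am: "abelian_monoid U"
    by (rule abelian_monoidI) (auto simp: V.a_assoc, metis W' V.a_comm)
  have mm: "comm_monoid U"
    by (rule comm_monoidI) (auto simp: V.m_assoc, metis W' V.m_comm)
  interpret csemiring U
  proof (intro csemiring.intro semiring.intro am mm comm_monoid.axioms(1)[OF mm])
    show "semiring_axioms U"
      by (rule semiring_axioms.intro) (auto simp: V.l_distr V.r_distr)
  qed
  show ?thesis
  proof
    show "\<one>\<^bsub>U\<^esub> \<oplus>\<^bsub>U\<^esub> \<one>\<^bsub>U\<^esub> = \<one>\<^bsub>U\<^esub> \<oplus>\<^bsub>U\<^esub> \<one>\<^bsub>U\<^esub> \<oplus>\<^bsub>U\<^esub> \<one>\<^bsub>U\<^esub> \<oplus>\<^bsub>U\<^esub> \<one>\<^bsub>U\<^esub>"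
      using V.one_plus_one by simp
    fix a b assume ab: "a \<in> carrier U" "b \<in> carrier U"
    then obtain x y where xy: "x \<in> W" "y \<in> W" "a = j x" "b = j y" by auto
    show "a \<oplus>\<^bsub>U\<^esub> b = a \<oplus>\<^bsub>U\<^esub> a" if "a \<oplus>\<^bsub>U\<^esub> a = b \<oplus>\<^bsub>U\<^esub> b"
      using that xy V.add_ghost[of x y] by simp
    show "a \<oplus>\<^bsub>U\<^esub> b \<in> {a, b}" if "a \<oplus>\<^bsub>U\<^esub> a \<noteq> b \<oplus>\<^bsub>U\<^esub> b"
      using that xy V.add_select[of x y] by auto
  qed
qed

lemma covers_small:
  fixes R :: "('r, 'x) ring_scheme" and M :: "('m, 'y) ring_scheme" and V :: "('u, 'z) ring_scheme"
  assumes cov: "covers R M v V \<psi>"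
  shows "\<exists>(U, \<phi>)\<in>Covers R M v. dominates R U \<phi> V \<psi> \<and> dominates R V \<psi> U \<phi>"
proof -
  from cov have sv: "supervaluation R V \<psi>" unfolding covers_def by blast
  from cov obtain \<iota> where iso: "\<iota> \<in> ring_iso M (ghosts V)"
    and \<iota>: "\<And>a. a \<in> carrier R \<Longrightarrow> ghost_of V \<psi> a = \<iota> (v a)" unfolding covers_def by blast
  interpret supervaluation R V \<psi> by (rule sv)
  define e where "e = ghost_unit V"
  have e: "e \<in> carrier V" unfolding e_def ghost_unit_def by simp
  have ee: "e \<otimes>\<^bsub>V\<^esub> e = e"
    unfolding e_def ghost_unit_def using U.one_plus_one by (simp add: U.l_distr U.a_assoc)
  have double: "x \<oplus>\<^bsub>V\<^esub> x = e \<otimes>\<^bsub>V\<^esub> x" if "x \<in> carrier V" for x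
    using that unfolding e_def ghost_unit_def by (simp add: U.l_distr)
  define G where "G = carrier (ghosts V)"
  have G_iff: "x \<in> G \<longleftrightarrow> (\<exists>y\<in>carrier V. x = e \<otimes>\<^bsub>V\<^esub> y)" for x
    unfolding G_def ghosts_def e_def by auto
  have G_carrier: "x \<in> carrier V" if "x \<in> G" for x using that e unfolding G_iff by auto
  have eG: "e \<otimes>\<^bsub>V\<^esub> x = x" if x: "x \<in> G" for x
  proof -
    obtain y where y: "y \<in> carrier V" "x = e \<otimes>\<^bsub>V\<^esub> y" using x unfolding G_iff by blast
    then show ?thesis using e by (simp add: U.m_assoc[symmetric] ee)
  qed
  have G_mult: "x \<otimes>\<^bsub>V\<^esub> y \<in> G" "y \<otimes>\<^bsub>V\<^esub> x \<in> G" if x: "x \<in> G" and y: "y \<in> carrier V" for x y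
  proof -
    have "x \<otimes>\<^bsub>V\<^esub> y = e \<otimes>\<^bsub>V\<^esub> (x \<otimes>\<^bsub>V\<^esub> y)"
      using eG[OF x] G_carrier[OF x] y e by (simp add: U.m_assoc[symmetric])
    then show "x \<otimes>\<^bsub>V\<^esub> y \<in> G" unfolding G_iff using G_carrier[OF x] y by blast
    then show "y \<otimes>\<^bsub>V\<^esub> x \<in> G" using G_carrier[OF x] y by (simp add: U.m_comm)
  qed
  define W where "W = \<psi> ` carrier R \<union> G"
  have W: "W \<subseteq> carrier V" unfolding W_def using closed G_carrier by auto
  have W': "x \<in> carrier V" if "x \<in> W" for x using that W by blast
  have GW: "x \<in> W" if "x \<in> G" for x using that W_def by blast
  have \<psi>W: "\<psi> a \<in> W" if "a \<in> carrier R" for a using that W_def by blast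
  have W0: "\<zero>\<^bsub>V\<^esub> \<in> W" using \<psi>W[OF R.zero_closed] map_zero by simp
  have W1: "\<one>\<^bsub>V\<^esub> \<in> W" using \<psi>W[OF R.one_closed] map_one by simp
  have W_add: "x \<oplus>\<^bsub>V\<^esub> y \<in> W" if xy: "x \<in> W" "y \<in> W" for x y
  proof (cases "x \<oplus>\<^bsub>V\<^esub> x = y \<oplus>\<^bsub>V\<^esub> y")
    case True
    then have "x \<oplus>\<^bsub>V\<^esub> y = e \<otimes>\<^bsub>V\<^esub> x" using U.add_ghost W' xy double by metis
    then show ?thesis using GW G_iff W' xy by blast
  next
    case False
    then show ?thesis using U.add_select W' xy by (metis insertE singletonD)
  qed
  have W_mult: "x \<otimes>\<^bsub>V\<^esub> y \<in> W" if xy: "x \<in> W" "y \<in> W" for x y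
  proof (cases "x \<in> G \<or> y \<in> G")
    case True
    then show ?thesis using G_mult GW W' xy by blast
  next
    case False
    then obtain a b where "a \<in> carrier R" "b \<in> carrier R" "x = \<psi> a" "y = \<psi> b"
      using xy unfolding W_def by blast
    then show ?thesis using \<psi>W[of "a \<otimes>\<^bsub>R\<^esub> b"] map_mult by simp
  qed
  have bij: "bij_betw \<iota> (carrier M) G"
    using ring_iso_memE(5)[OF iso] unfolding G_def .
  define j where "j x = (if x \<in> G then Inr (inv_into (carrier M) \<iota> x)
    else Inl {a \<in> carrier R. \<psi> a = x})" for x
  have inj: "inj_on j W"
  proof (rule inj_onI)
    fix x y assume xy: "x \<in> W" "y \<in> W" "j x = j y"
    show "x = y"
    proof (cases "x \<in> G")
      case True
      then have "y \<in> G" "inv_into (carrier M) \<iota> x = inv_into (carrier M) \<iota> y"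
        using xy(3) unfolding j_def by (auto split: if_splits)
      then show ?thesis using True bij by (metis bij_betw_inv_into_right)
    next
      case False
      then have "{a \<in> carrier R. \<psi> a = x} = {a \<in> carrier R. \<psi> a = y}"
        using xy(3) unfolding j_def by (auto split: if_splits)
      moreover obtain a where "a \<in> carrier R" "\<psi> a = x" using xy(1) False unfolding W_def by blast
      ultimately show ?thesis by blast
    qed
  qed
  define k where "k = inv_into W j"
  have kj: "k (j x) = x" if "x \<in> W" for x unfolding k_def using inj that by simp
  have jeq: "j x = j y \<longleftrightarrow> x = y" if "x \<in> W" "y \<in> W" for x y
    using that inj by (auto simp: inj_on_def)
  define U :: "('r set + 'm) ring" where "U = \<lparr>carrier = j ` W,
    monoid.mult = (\<lambda>x y. j (k x \<otimes>\<^bsub>V\<^esub> k y)), one = j \<one>\<^bsub>V\<^esub>, ring.zero = j \<zero>\<^bsub>V\<^esub>,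
    ring.add = (\<lambda>x y. j (k x \<oplus>\<^bsub>V\<^esub> k y))\<rparr>"
  define \<phi> where "\<phi> a = j (\<psi> a)" for a
  have Uc: "carrier U = j ` W" and U0: "\<zero>\<^bsub>U\<^esub> = j \<zero>\<^bsub>V\<^esub>" and U1: "\<one>\<^bsub>U\<^esub> = j \<one>\<^bsub>V\<^esub>"
    unfolding U_def by simp_all
  have Ua: "j x \<oplus>\<^bsub>U\<^esub> j y = j (x \<oplus>\<^bsub>V\<^esub> y)" and Um: "j x \<otimes>\<^bsub>U\<^esub> j y = j (x \<otimes>\<^bsub>V\<^esub> y)"
    if "x \<in> W" "y \<in> W" for x y
    using that unfolding U_def by (simp_all add: kj)
  have stU: "supertropical U"
    by (rule supertropical_image[OF U.supertropical_axioms W W0 W1 W_add W_mult inj Uc U0 U1 Ua Um])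
  have e1: "e = \<one>\<^bsub>V\<^esub> \<oplus>\<^bsub>V\<^esub> \<one>\<^bsub>V\<^esub>" unfolding e_def ghost_unit_def ..
  have eW: "e \<in> W" unfolding e1 by (intro W_add W1)
  have eU: "ghost_unit U = j e" unfolding ghost_unit_def U1 e1 by (simp add: Ua W1)
  have GU: "carrier (ghosts U) = j ` G"
  proof -
    have "carrier (ghosts U) = (\<lambda>x. j (e \<otimes>\<^bsub>V\<^esub> x)) ` W"
      unfolding ghosts_def by (simp add: eU Uc image_image Um eW)
    also have "\<dots> = j ` G"
    proof (intro subset_antisym subsetI)
      fix z assume "z \<in> (\<lambda>x. j (e \<otimes>\<^bsub>V\<^esub> x)) ` W"
      then show "z \<in> j ` G" using G_iff W' by blast
    next
      fix z assume "z \<in> j ` G"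
      then obtain x where "x \<in> G" "z = j x" by blast
      then show "z \<in> (\<lambda>x. j (e \<otimes>\<^bsub>V\<^esub> x)) ` W"
        using eG[of x] GW[of x] by (intro image_eqI[where x = x]) simp_all
    qed
    finally show ?thesis .
  qed
  have gW: "ghost_of V \<psi> a \<in> W" if "a \<in> carrier R" for a
    unfolding ghost_of_def e_def[symmetric] using that by (intro W_mult eW \<psi>W)
  have gU: "ghost_of U \<phi> a = j (ghost_of V \<psi> a)" if "a \<in> carrier R" for a
    unfolding ghost_of_def \<phi>_def eU e_def[symmetric] using that by (intro Um eW \<psi>W)
  have leU: "bip_le (ghosts U) (j x) (j y) \<longleftrightarrow> bip_le (ghosts V) x y" if "x \<in> W" "y \<in> W" for x y
  proof -
    have "j x \<oplus>\<^bsub>U\<^esub> j y = j y \<longleftrightarrow> x \<oplus>\<^bsub>V\<^esub> y = y"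
      using that by (simp add: Ua jeq W_add)
    then show ?thesis unfolding bip_le_def ghosts_def by simp
  qed
  have svU: "supervaluation R U \<phi>"
  proof (intro supervaluation.intro stU R.csemiring_axioms supervaluation_axioms.intro)
    show "\<phi> \<in> carrier R \<rightarrow> carrier U" unfolding \<phi>_def Uc using \<psi>W by auto
    show "\<phi> \<zero>\<^bsub>R\<^esub> = \<zero>\<^bsub>U\<^esub>" "\<phi> \<one>\<^bsub>R\<^esub> = \<one>\<^bsub>U\<^esub>" unfolding \<phi>_def U0 U1 map_zero map_one by simp_all
    fix a b assume ab: "a \<in> carrier R" "b \<in> carrier R"
    show "\<phi> (a \<otimes>\<^bsub>R\<^esub> b) = \<phi> a \<otimes>\<^bsub>U\<^esub> \<phi> b"
      unfolding \<phi>_def using ab by (simp add: map_mult Um \<psi>W)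
    show "bip_le (ghosts U) (ghost_of U \<phi> (a \<oplus>\<^bsub>R\<^esub> b)) (ghost_of U \<phi> a \<oplus>\<^bsub>U\<^esub> ghost_of U \<phi> b)"
      using ab map_add[OF ab] by (simp add: gU gW Ua leU W_add)
  qed
  have \<iota>G: "\<iota> x \<in> G" if "x \<in> carrier M" for x using bij that by (auto simp: bij_betw_def)
  have isoU: "(\<lambda>x. j (\<iota> x)) \<in> ring_iso M (ghosts U)"
  proof (rule ring_iso_memI)
    fix x assume x: "x \<in> carrier M"
    then show "j (\<iota> x) \<in> carrier (ghosts U)" unfolding GU using \<iota>G by blast
    fix y assume y: "y \<in> carrier M"
    have xy: "\<iota> x \<in> W" "\<iota> y \<in> W" using \<iota>G GW x y by blast+
    show "j (\<iota> (x \<otimes>\<^bsub>M\<^esub> y)) = j (\<iota> x) \<otimes>\<^bsub>ghosts U\<^esub> j (\<iota> y)"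
      "j (\<iota> (x \<oplus>\<^bsub>M\<^esub> y)) = j (\<iota> x) \<oplus>\<^bsub>ghosts U\<^esub> j (\<iota> y)"
      using ring_iso_memE(2,3)[OF iso x y] Um[OF xy] Ua[OF xy] by (simp_all add: ghosts_def)
  next
    show "j (\<iota> \<one>\<^bsub>M\<^esub>) = \<one>\<^bsub>ghosts U\<^esub>"
      using ring_iso_memE(4)[OF iso] by (simp add: ghosts_def eU e_def)
    have "bij_betw j G (j ` G)"
      using inj GW by (intro bij_betw_imageI) (auto simp: inj_on_def)
    then show "bij_betw (\<lambda>x. j (\<iota> x)) (carrier M) (carrier (ghosts U))"
      using bij_betw_trans[OF bij] unfolding GU comp_def by blast
  qed
  have "covers R M v U \<phi>"
    unfolding covers_def using svU isoU gU \<iota> by (intro conjI bexI[OF _ isoU]) simp_all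
  moreover have "\<phi> a = \<phi> b \<longleftrightarrow> \<psi> a = \<psi> b" if "a \<in> carrier R" "b \<in> carrier R" for a b
    unfolding \<phi>_def using that by (simp add: jeq \<psi>W)
  moreover have "\<phi> a \<in> carrier (ghosts U) \<longleftrightarrow> \<psi> a \<in> carrier (ghosts V)" if "a \<in> carrier R" for a
    unfolding GU \<phi>_def G_def[symmetric] using that jeq GW \<psi>W by blast
  ultimately have "(U, \<phi>) \<in> Covers R M v" "dominates R U \<phi> V \<psi>" "dominates R V \<psi> U \<phi>"
    unfolding Covers_def dominates_def by (simp_all add: gU gW leU)
  then show ?thesis by blast
qed

end

theory Submission
  imports Defs
begin

text \<open>
  A very strong cover \<open>\<psi>\<close> of \<open>v\<close> cannot see a summand of smaller value: \<open>\<psi> (a + c) = \<psi> a\<close> whenever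
  \<open>v c < v a\<close>. Hence, if \<open>a + c = b + d\<close> with \<open>v c < v a\<close> and \<open>v d < v b\<close>, then
  \<open>\<psi> a = \<psi> (a + c) = \<psi> (b + d) = \<psi> b\<close>. If instead \<open>v a = v b = 0\<close>, then \<open>\<psi> a\<close> and \<open>\<psi> b\<close> have ghost \<open>0\<close>
  and are therefore both \<open>0\<close>. So every very strong cover of \<open>v\<close> is constant on the
  classes of \<open>val_rel\<close>, and these classes are the fibres of \<open>\<chi>\<close>. This is the first condition for
  dominance. The second one holds between any two covers of \<open>v\<close>, since both ghost orders are the
  order of \<open>M\<close>; the third one is about the kernel of \<open>v\<close> alone, because \<open>\<chi> a\<close> is tangible everywhere
  else. This is \<open>chi_dominates\<close>.

  To be the top element, \<open>\<chi>\<close> must itself be a cover of \<open>v\<close> that is tangible, strong and very strong.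
  The relation \<open>val_rel\<close> is transitive because the sum of two terms smaller than \<open>v a\<close> is smaller than
  \<open>v a\<close>, and it respects products because multiplication by a nonzero element of \<open>M\<close> is strictly
  monotone, which is what cancellation gives. Strict monotonicity is also the reason for the
  distributive law in the target of \<open>\<chi>\<close>, where a sum is the summand with the larger ghost, and a ghost
  if the two tie. Finally \<open>a + c\<close> lies in the class of \<open>a\<close> when \<open>v c < v a\<close>, so \<open>\<chi>\<close> is strong.

  A tangible strong supervaluation is very strong (\<open>tangible_strong_imp_very_strong\<close>). Hence \<open>\<chi>\<close> is
  very strong, and it dominates the tangible strong covers as well.
\<close>

section \<open>The order of a bipotent semiring\<close>

context bipotent_semiring
begin

abbreviation le (infix "\<^bold>\<le>" 50) where "x \<^bold>\<le> y \<equiv> bip_le M x y"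
abbreviation less (infix "\<^bold><" 50) where "x \<^bold>< y \<equiv> bip_less M x y"

lemma le_refl: "a \<in> carrier M \<Longrightarrow> a \<^bold>\<le> a"
  using bipotent[of a a] by (simp add: bip_le_def)

lemma le_antisym: "\<lbrakk>a \<in> carrier M; b \<in> carrier M; a \<^bold>\<le> b; b \<^bold>\<le> a\<rbrakk> \<Longrightarrow> a = b"
  by (metis a_comm bip_le_def)

lemma le_trans:
  "\<lbrakk>a \<in> carrier M; b \<in> carrier M; c \<in> carrier M; a \<^bold>\<le> b; b \<^bold>\<le> c\<rbrakk> \<Longrightarrow> a \<^bold>\<le> c"
  by (metis a_assoc bip_le_def)

lemma less_or_eq_or_greater:
  "\<lbrakk>a \<in> carrier M; b \<in> carrier M\<rbrakk> \<Longrightarrow> a \<^bold>< b \<or> a = b \<or> b \<^bold>< a"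
  using bipotent[of a b] by (auto simp: bip_le_def bip_less_def a_comm)

lemma less_not_sym: "\<lbrakk>a \<in> carrier M; b \<in> carrier M; a \<^bold>< b\<rbrakk> \<Longrightarrow> \<not> b \<^bold>< a"
  using le_antisym by (auto simp: bip_less_def)

lemma less_irrefl [simp]: "\<not> a \<^bold>< a"
  by (simp add: bip_less_def)

lemma less_trans:
  "\<lbrakk>a \<in> carrier M; b \<in> carrier M; c \<in> carrier M; a \<^bold>< b; b \<^bold>< c\<rbrakk> \<Longrightarrow> a \<^bold>< c"
  using le_trans le_antisym unfolding bip_less_def by metis

lemma le_less_trans:
  "\<lbrakk>a \<in> carrier M; b \<in> carrier M; c \<in> carrier M; a \<^bold>\<le> b; b \<^bold>< c\<rbrakk> \<Longrightarrow> a \<^bold>< c"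
  using le_trans le_antisym unfolding bip_less_def by metis

lemma add_less: "\<lbrakk>a \<in> carrier M; b \<in> carrier M; a \<^bold>< c; b \<^bold>< c\<rbrakk> \<Longrightarrow> a \<oplus> b \<^bold>< c"
  using bipotent[of a b] by auto

lemma zero_less_iff: "a \<in> carrier M \<Longrightarrow> \<zero> \<^bold>< a \<longleftrightarrow> a \<noteq> \<zero>"
  by (auto simp: bip_le_def bip_less_def)

lemma less_imp_nonzero: "\<lbrakk>a \<in> carrier M; a \<^bold>< b\<rbrakk> \<Longrightarrow> b \<noteq> \<zero>"
  by (auto simp: bip_le_def bip_less_def)

end


section \<open>Supertropical semirings\<close>

context supertropical
begin

lemma ghost_unit_closed: "ghost_unit U \<in> carrier U"
  by (simp add: ghost_unit_def)

lemma double_eq_ghost: "x \<in> carrier U \<Longrightarrow> x \<oplus> x = ghost_unit U \<otimes> x"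
  by (simp add: ghost_unit_def l_distr)

text \<open>If \<open>ex = 0 = e0\<close>, then \<open>x + 0\<close> is the ghost \<open>ex\<close>, by the axiom on elements with equal ghosts.\<close>

lemma ghost_eq_zero:
  assumes x: "x \<in> carrier U" and ghost: "ghost_unit U \<otimes> x = \<zero>"
  shows "x = \<zero>"
proof -
  have "x \<oplus> x = \<zero> \<oplus> \<zero>" using double_eq_ghost[OF x] ghost by simp
  then have "x \<oplus> \<zero> = x \<oplus> x" using x add_ghost by blast
  then show ?thesis using double_eq_ghost[OF x] x ghost by simp
qed

lemma add_eq_right_if_ghost_less:
  assumes xy: "x \<in> carrier U" "y \<in> carrier U"
    and less: "bip_less (ghosts U) (ghost_unit U \<otimes> x) (ghost_unit U \<otimes> y)"
  shows "x \<oplus> y = y"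
proof (rule ccontr)
  note e = ghost_unit_closed
  have sum: "ghost_unit U \<otimes> x \<oplus> ghost_unit U \<otimes> y = ghost_unit U \<otimes> y"
    and ne: "ghost_unit U \<otimes> x \<noteq> ghost_unit U \<otimes> y"
    using less by (simp_all add: bip_less_def bip_le_def ghosts_def)
  have "x \<oplus> y \<in> {x, y}" using xy ne by (intro add_select) (simp_all add: double_eq_ghost)
  moreover assume "x \<oplus> y \<noteq> y"
  ultimately have "ghost_unit U \<otimes> (x \<oplus> y) = ghost_unit U \<otimes> x" by auto
  then show False using sum ne xy e by (simp add: r_distr)
qed

end

text \<open>
  If the ghost of \<open>\<phi> a\<close> is below that of \<open>\<phi> b\<close>, then \<open>\<phi> a + \<phi> b = \<phi> b\<close> holds in any supertropical
  semiring. Tangibility of \<open>\<phi> b\<close> lets tangible additivity read the left side as \<open>\<phi> (a + b)\<close>.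
\<close>

lemma tangible_strong_imp_very_strong:
  fixes R :: "('r, 'x) ring_scheme" and U :: "('u, 'y) ring_scheme"
  assumes "supervaluation R U \<phi>" and tan: "tangible R U \<phi>" and strong: "strong R U \<phi>"
  shows "very_strong R U \<phi>"
  unfolding very_strong_def
proof (intro ballI impI)
  interpret supervaluation R U \<phi> by fact
  fix a b assume ab: "a \<in> carrier R" "b \<in> carrier R"
    and less: "bip_less (ghosts U) (ghost_of U \<phi> a) (ghost_of U \<phi> b)"
  have \<phi>: "\<phi> a \<in> carrier U" "\<phi> b \<in> carrier U" using ab closed by auto
  note e = U.ghost_unit_closed
  have sum: "\<phi> a \<oplus>\<^bsub>U\<^esub> \<phi> b = \<phi> b"
    using U.add_eq_right_if_ghost_less[OF \<phi>] less by (simp add: ghost_of_def)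
  \<comment> \<open>Only \<open>0\<close> could fail to be tangible here, and nothing lies strictly below \<open>e0 = 0\<close>.\<close>
  have "\<phi> b \<noteq> \<zero>\<^bsub>U\<^esub>"
    using less \<phi> e by (auto simp: ghost_of_def bip_less_def bip_le_def ghosts_def)
  then have "\<phi> b \<in> tangibles U" using tan ab unfolding tangible_def by blast
  then have "\<phi> a \<oplus>\<^bsub>U\<^esub> \<phi> b = \<phi> (a \<oplus>\<^bsub>R\<^esub> b)"
    using strong ab sum unfolding strong_def tangibly_additive_def by metis
  then show "\<phi> (a \<oplus>\<^bsub>R\<^esub> b) = \<phi> b" using sum by simp
qed


section \<open>Strong valuations and the congruence modulo smaller terms\<close>

context valuation
begin

lemma v_carrier [simp]: "a \<in> carrier R \<Longrightarrow> v a \<in> carrier M"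
  using v_closed by auto

lemma mult_nonzero:
  "\<lbrakk>x \<in> carrier M; y \<in> carrier M; x \<noteq> \<zero>\<^bsub>M\<^esub>; y \<noteq> \<zero>\<^bsub>M\<^esub>\<rbrakk> \<Longrightarrow> x \<otimes>\<^bsub>M\<^esub> y \<noteq> \<zero>\<^bsub>M\<^esub>"
  using monoid.m_closed[OF comm_monoid.axioms(1)[OF comm_monoid_cancel.axioms(2)[OF cancellative]], of x y]
  by auto

lemma mult_left_cancel_nonzero:
  "\<lbrakk>x \<in> carrier M; y \<in> carrier M; z \<in> carrier M; x \<noteq> \<zero>\<^bsub>M\<^esub>; y \<noteq> \<zero>\<^bsub>M\<^esub>; z \<noteq> \<zero>\<^bsub>M\<^esub>;
    z \<otimes>\<^bsub>M\<^esub> x = z \<otimes>\<^bsub>M\<^esub> y\<rbrakk> \<Longrightarrow> x = y"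
  using monoid_cancel.l_cancel[OF comm_monoid_cancel.axioms(1)[OF cancellative], of z x y]
  by auto

lemma one_nonzero: "\<one>\<^bsub>M\<^esub> \<noteq> \<zero>\<^bsub>M\<^esub>"
  using nontrivial M.l_one M.l_null M.zero_closed by force

text \<open>
  Strictness is where cancellation enters; the case \<open>x = 0\<close>, which cancellation does not reach, uses
  that \<open>M\<close> has no zero divisors.
\<close>

lemma mult_strict_mono:
  assumes x: "x \<in> carrier M" and y: "y \<in> carrier M" and z: "z \<in> carrier M"
    and less: "bip_less M x y" and z0: "z \<noteq> \<zero>\<^bsub>M\<^esub>"
  shows "bip_less M (z \<otimes>\<^bsub>M\<^esub> x) (z \<otimes>\<^bsub>M\<^esub> y)"
proof -
  have "bip_le M (z \<otimes>\<^bsub>M\<^esub> x) (z \<otimes>\<^bsub>M\<^esub> y)"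
    using less x y z by (simp add: bip_less_def bip_le_def M.r_distr[symmetric])
  moreover have "z \<otimes>\<^bsub>M\<^esub> x \<noteq> z \<otimes>\<^bsub>M\<^esub> y"
  proof
    assume eq: "z \<otimes>\<^bsub>M\<^esub> x = z \<otimes>\<^bsub>M\<^esub> y"
    have y0: "y \<noteq> \<zero>\<^bsub>M\<^esub>" using M.less_imp_nonzero[OF x less] .
    then have "x \<noteq> \<zero>\<^bsub>M\<^esub>" using eq mult_nonzero[OF z y z0 y0] z by auto
    then show False
      using mult_left_cancel_nonzero[OF x y z _ y0 z0 eq] less by (simp add: bip_less_def)
  qed
  ultimately show ?thesis by (simp add: bip_less_def)
qed

lemma v_add_less:
  assumes "a \<in> carrier R" "b \<in> carrier R" "c \<in> carrier R"
    "bip_less M (v a) (v c)" "bip_less M (v b) (v c)"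
  shows "bip_less M (v (a \<oplus>\<^bsub>R\<^esub> b)) (v c)"
  using assms by (intro M.le_less_trans[OF _ _ _ v_add M.add_less]) auto

end

locale strongly_valued = valuation R M v
  for R :: "('r, 'x) ring_scheme" and M :: "('m, 'y) ring_scheme" and v :: "'r \<Rightarrow> 'm" +
  assumes strong: "strong_map R M v"
begin

lemma v_add_eq_left:
  "\<lbrakk>a \<in> carrier R; c \<in> carrier R; bip_less M (v c) (v a)\<rbrakk> \<Longrightarrow> v (a \<oplus>\<^bsub>R\<^esub> c) = v a"
  using strong M.less_not_sym[of "v c" "v a"] v_carrier[of a] v_carrier[of c]
  by (auto simp: strong_map_def bip_max_def bip_less_def)

abbreviation rel (infix "\<sim>" 50) where "a \<sim> b \<equiv> (a, b) \<in> val_rel R M v"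

abbreviation cls ("\<langle>_\<rangle>") where "\<langle>a\<rangle> \<equiv> val_rel R M v `` {a}"

lemma rel_carrier: "a \<sim> b \<Longrightarrow> a \<in> carrier R" "a \<sim> b \<Longrightarrow> b \<in> carrier R"
  by (auto simp: val_rel_def)

lemma rel_cases:
  assumes "a \<sim> b"
  obtains (zero) "v a = \<zero>\<^bsub>M\<^esub>" "v b = \<zero>\<^bsub>M\<^esub>"
  | (sum) c d where "c \<in> carrier R" "d \<in> carrier R" "bip_less M (v c) (v a)"
      "bip_less M (v d) (v b)" "a \<oplus>\<^bsub>R\<^esub> c = b \<oplus>\<^bsub>R\<^esub> d"
  using assms by (auto simp: val_rel_def)

lemma rel_imp_v_eq:
  assumes ab: "a \<sim> b"
  shows "v a = v b"
  using ab
proof (cases rule: rel_cases)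
  case (sum c d)
  then show ?thesis
    using v_add_eq_left[of a c] v_add_eq_left[of b d] rel_carrier[OF ab] by simp
qed simp

lemma rel_nonzeroI:
  "\<lbrakk>a \<in> carrier R; b \<in> carrier R; c \<in> carrier R; d \<in> carrier R;
    bip_less M (v c) (v a); bip_less M (v d) (v b); a \<oplus>\<^bsub>R\<^esub> c = b \<oplus>\<^bsub>R\<^esub> d\<rbrakk> \<Longrightarrow> a \<sim> b"
  by (auto simp: val_rel_def)

lemma rel_zeroI: "\<lbrakk>a \<in> carrier R; b \<in> carrier R; v a = \<zero>\<^bsub>M\<^esub>; v b = \<zero>\<^bsub>M\<^esub>\<rbrakk> \<Longrightarrow> a \<sim> b"
  by (auto simp: val_rel_def)

lemma rel_trans:
  assumes ab: "a \<sim> b" and bc: "b \<sim> c"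
  shows "a \<sim> c"
proof (cases "v b = \<zero>\<^bsub>M\<^esub>")
  case True
  then show ?thesis
    using rel_imp_v_eq[OF ab] rel_imp_v_eq[OF bc] rel_carrier[OF ab] rel_carrier[OF bc]
    by (intro rel_zeroI) auto
next
  case False
  note abc = rel_carrier(1)[OF ab] rel_carrier[OF bc]
  have v: "v a = v b" "v c = v b" using rel_imp_v_eq[OF ab] rel_imp_v_eq[OF bc] by simp_all
  obtain s t where st: "s \<in> carrier R" "t \<in> carrier R" "bip_less M (v s) (v b)"
      "bip_less M (v t) (v b)" "a \<oplus>\<^bsub>R\<^esub> s = b \<oplus>\<^bsub>R\<^esub> t"
    using ab False v by (cases rule: rel_cases) auto
  obtain p q where pq: "p \<in> carrier R" "q \<in> carrier R" "bip_less M (v p) (v b)"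
      "bip_less M (v q) (v b)" "b \<oplus>\<^bsub>R\<^esub> p = c \<oplus>\<^bsub>R\<^esub> q"
    using bc False v by (cases rule: rel_cases) auto
  \<comment> \<open>\<open>a + (s + p) = b + t + p = c + (q + t)\<close>, and the added terms remain smaller than \<open>v b\<close>.\<close>
  have "a \<oplus>\<^bsub>R\<^esub> (s \<oplus>\<^bsub>R\<^esub> p) = (b \<oplus>\<^bsub>R\<^esub> t) \<oplus>\<^bsub>R\<^esub> p"
    using abc st pq by (simp add: R.a_assoc[symmetric])
  also have "\<dots> = (b \<oplus>\<^bsub>R\<^esub> p) \<oplus>\<^bsub>R\<^esub> t" using abc st(1,2) pq(1,2) by (simp add: R.a_ac)
  also have "\<dots> = c \<oplus>\<^bsub>R\<^esub> (q \<oplus>\<^bsub>R\<^esub> t)"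
    unfolding pq(5) using abc st(1,2) pq(1,2) by (simp add: R.a_assoc)
  finally have "a \<oplus>\<^bsub>R\<^esub> (s \<oplus>\<^bsub>R\<^esub> p) = c \<oplus>\<^bsub>R\<^esub> (q \<oplus>\<^bsub>R\<^esub> t)" .
  then show ?thesis
    using abc st pq v v_add_less by (intro rel_nonzeroI[of a c "s \<oplus>\<^bsub>R\<^esub> p" "q \<oplus>\<^bsub>R\<^esub> t"]) auto
qed

lemma rel_refl: "a \<in> carrier R \<Longrightarrow> a \<sim> a"
  by (cases "v a = \<zero>\<^bsub>M\<^esub>")
    (auto intro: rel_zeroI rel_nonzeroI[of a a "\<zero>\<^bsub>R\<^esub>" "\<zero>\<^bsub>R\<^esub>"] simp: v_zero M.zero_less_iff)

lemma equiv_rel: "equiv (carrier R) (val_rel R M v)"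
proof (rule equivI)
  show "val_rel R M v \<subseteq> carrier R \<times> carrier R" using rel_carrier by auto
  show "refl_on (carrier R) (val_rel R M v)" using rel_refl rel_carrier by (auto simp: refl_on_def)
  show "sym (val_rel R M v)" by (rule symI) (auto simp: val_rel_def dest: sym)
  show "trans (val_rel R M v)" using rel_trans by (auto simp: trans_def)
qed

lemma rel_mult_left:
  assumes ab: "a \<sim> b" and c: "c \<in> carrier R"
  shows "c \<otimes>\<^bsub>R\<^esub> a \<sim> c \<otimes>\<^bsub>R\<^esub> b"
proof (cases "v a = \<zero>\<^bsub>M\<^esub> \<or> v c = \<zero>\<^bsub>M\<^esub>")
  case True
  then show ?thesis
    using rel_imp_v_eq[OF ab] rel_carrier[OF ab] c by (intro rel_zeroI) (auto simp: v_mult)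
next
  case False
  note cab = rel_carrier[OF ab] c
  obtain s t where st: "s \<in> carrier R" "t \<in> carrier R" "bip_less M (v s) (v a)"
      "bip_less M (v t) (v b)" "a \<oplus>\<^bsub>R\<^esub> s = b \<oplus>\<^bsub>R\<^esub> t"
    using ab False by (cases rule: rel_cases) auto
  show ?thesis
  proof (rule rel_nonzeroI[where c = "c \<otimes>\<^bsub>R\<^esub> s" and d = "c \<otimes>\<^bsub>R\<^esub> t"])
    show "c \<otimes>\<^bsub>R\<^esub> a \<oplus>\<^bsub>R\<^esub> c \<otimes>\<^bsub>R\<^esub> s = c \<otimes>\<^bsub>R\<^esub> b \<oplus>\<^bsub>R\<^esub> c \<otimes>\<^bsub>R\<^esub> t"
      using cab st by (simp add: R.r_distr[symmetric])
  qed (use False cab st in \<open>auto simp: v_mult intro!: mult_strict_mono\<close>)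
qed

lemma rel_mult:
  assumes ab: "a \<sim> b" and cd: "c \<sim> d"
  shows "a \<otimes>\<^bsub>R\<^esub> c \<sim> b \<otimes>\<^bsub>R\<^esub> d"
proof -
  have "a \<otimes>\<^bsub>R\<^esub> c \<sim> a \<otimes>\<^bsub>R\<^esub> d" using rel_mult_left[OF cd] rel_carrier[OF ab] by blast
  moreover have "a \<otimes>\<^bsub>R\<^esub> d \<sim> b \<otimes>\<^bsub>R\<^esub> d"
    using rel_mult_left[OF ab, of d] rel_carrier[OF ab] rel_carrier[OF cd] by (simp add: R.m_comm)
  ultimately show ?thesis by (rule rel_trans)
qed

lemma cls_eq_iff: "\<lbrakk>a \<in> carrier R; b \<in> carrier R\<rbrakk> \<Longrightarrow> \<langle>a\<rangle> = \<langle>b\<rangle> \<longleftrightarrow> a \<sim> b"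
  using eq_equiv_class_iff[OF equiv_rel] by blast

text \<open>This makes \<open>\<chi>\<close> tangibly additive; the witnesses come from \<open>(a + c) + 0 = a + c\<close>.\<close>

lemma cls_add_eq_left:
  assumes "a \<in> carrier R" "c \<in> carrier R" "bip_less M (v c) (v a)"
  shows "\<langle>a \<oplus>\<^bsub>R\<^esub> c\<rangle> = \<langle>a\<rangle>"
proof -
  have "bip_less M (v \<zero>\<^bsub>R\<^esub>) (v a)"
    using M.less_imp_nonzero[of "v c"] assms by (simp add: v_zero M.zero_less_iff)
  then have "a \<oplus>\<^bsub>R\<^esub> c \<sim> a"
    using assms v_add_eq_left by (intro rel_nonzeroI[of _ _ "\<zero>\<^bsub>R\<^esub>" c]) auto
  then show ?thesis using assms by (simp add: cls_eq_iff)
qed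


section \<open>The supertropical semiring of classes\<close>

abbreviation S :: "('r set + 'm) ring" where "S \<equiv> chi_semiring R M v"

abbreviation g :: "'r set + 'm \<Rightarrow> 'm" where "g \<equiv> chi_ghost v"

lemma the_elem_v_cls [simp]: "a \<in> carrier R \<Longrightarrow> the_elem (v ` \<langle>a\<rangle>) = v a"
proof -
  assume a: "a \<in> carrier R"
  have "v ` \<langle>a\<rangle> = {v a}"
  proof
    show "v ` \<langle>a\<rangle> \<subseteq> {v a}" using rel_imp_v_eq[of a] by fastforce
    show "{v a} \<subseteq> v ` \<langle>a\<rangle>" using rel_refl[OF a] by blast
  qed
  then show ?thesis by simp
qed

lemma S_cases:
  assumes "x \<in> carrier S"
  obtains (tangible) a where "a \<in> carrier R" "v a \<noteq> \<zero>\<^bsub>M\<^esub>" "x = Inl \<langle>a\<rangle>"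
  | (ghost) m where "m \<in> carrier M" "x = Inr m"
  using assms by (auto simp: chi_semiring_def val_kernel_def quotient_def)

lemma Inl_in_S: "\<lbrakk>a \<in> carrier R; v a \<noteq> \<zero>\<^bsub>M\<^esub>\<rbrakk> \<Longrightarrow> Inl \<langle>a\<rangle> \<in> carrier S"
  by (auto simp: chi_semiring_def val_kernel_def quotient_def)

lemma Inr_in_S [simp]: "Inr m \<in> carrier S \<longleftrightarrow> m \<in> carrier M"
  by (auto simp: chi_semiring_def)

lemma g_carrier [simp]: "x \<in> carrier S \<Longrightarrow> g x \<in> carrier M"
  by (cases x rule: S_cases) auto

text \<open>
  The laws of \<open>S\<close> that involve addition come down to the order of \<open>M\<close>, because \<open>g\<close> decides which
  summand survives. This works since \<open>g\<close> is multiplicative and has trivial kernel: no class outside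
  the kernel of \<open>v\<close> has ghost \<open>0\<close>.
\<close>

lemma g_eq_zero: "\<lbrakk>x \<in> carrier S; g x = \<zero>\<^bsub>M\<^esub>\<rbrakk> \<Longrightarrow> x = Inr \<zero>\<^bsub>M\<^esub>"
  by (cases x rule: S_cases) auto

lemma zero_S: "\<zero>\<^bsub>S\<^esub> = Inr \<zero>\<^bsub>M\<^esub>"
  and one_S: "\<one>\<^bsub>S\<^esub> = Inl \<langle>\<one>\<^bsub>R\<^esub>\<rangle>"
  by (simp_all add: chi_semiring_def)

lemma one_S_closed: "\<one>\<^bsub>S\<^esub> \<in> carrier S"
  using Inl_in_S[of "\<one>\<^bsub>R\<^esub>"] one_nonzero by (simp add: one_S v_one)

lemma mult_Inl_Inl:
  assumes "a \<in> carrier R" "b \<in> carrier R"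
  shows "Inl \<langle>a\<rangle> \<otimes>\<^bsub>S\<^esub> Inl \<langle>b\<rangle> = Inl \<langle>a \<otimes>\<^bsub>R\<^esub> b\<rangle>"
proof -
  have "\<langle>c \<otimes>\<^bsub>R\<^esub> d\<rangle> = \<langle>a \<otimes>\<^bsub>R\<^esub> b\<rangle>" if "a \<sim> c" "b \<sim> d" for c d
    using rel_mult[OF that] equiv_class_eq[OF equiv_rel] by blast
  then have "(\<Union>c\<in>\<langle>a\<rangle>. \<Union>d\<in>\<langle>b\<rangle>. \<langle>c \<otimes>\<^bsub>R\<^esub> d\<rangle>) = (\<Union>c\<in>\<langle>a\<rangle>. \<Union>d\<in>\<langle>b\<rangle>. \<langle>a \<otimes>\<^bsub>R\<^esub> b\<rangle>)"
    by (intro SUP_cong refl) auto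
  also have "\<dots> = \<langle>a \<otimes>\<^bsub>R\<^esub> b\<rangle>" using rel_refl assms by blast
  finally show ?thesis by (simp add: chi_semiring_def)
qed

lemma mult_Inr: "x \<otimes>\<^bsub>S\<^esub> Inr m = Inr (g x \<otimes>\<^bsub>M\<^esub> m)" "Inr m \<otimes>\<^bsub>S\<^esub> x = Inr (m \<otimes>\<^bsub>M\<^esub> g x)"
  by (cases x; simp add: chi_semiring_def)+

lemma mult_S_closed: "\<lbrakk>x \<in> carrier S; y \<in> carrier S\<rbrakk> \<Longrightarrow> x \<otimes>\<^bsub>S\<^esub> y \<in> carrier S"
  by (cases x rule: S_cases; cases y rule: S_cases)
    (use mult_nonzero in \<open>auto simp: mult_Inl_Inl mult_Inr v_mult intro!: Inl_in_S\<close>)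

lemma g_mult: "\<lbrakk>x \<in> carrier S; y \<in> carrier S\<rbrakk> \<Longrightarrow> g (x \<otimes>\<^bsub>S\<^esub> y) = g x \<otimes>\<^bsub>M\<^esub> g y"
  by (cases x rule: S_cases; cases y rule: S_cases) (auto simp: mult_Inl_Inl mult_Inr v_mult)

lemma add_S: "x \<oplus>\<^bsub>S\<^esub> y = chi_add M v x y"
  by (simp add: chi_semiring_def)

lemma add_S_eq_left:
    "bip_less M (g y) (g x) \<Longrightarrow> x \<oplus>\<^bsub>S\<^esub> y = x"
  and add_S_eq_right:
    "\<lbrakk>x \<in> carrier S; y \<in> carrier S; bip_less M (g x) (g y)\<rbrakk> \<Longrightarrow> x \<oplus>\<^bsub>S\<^esub> y = y"
  and add_S_eq_ghost: "g x = g y \<Longrightarrow> x \<oplus>\<^bsub>S\<^esub> y = Inr (g y)"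
  using M.less_not_sym[of "g x" "g y"] by (auto simp: add_S chi_add_def)

lemma ghost_cases [consumes 2, case_names less eq greater]:
  assumes "x \<in> carrier S" "y \<in> carrier S"
  obtains "bip_less M (g x) (g y)" | "g x = g y" | "bip_less M (g y) (g x)"
  using M.less_or_eq_or_greater[of "g x" "g y"] assms by auto

lemma add_S_closed: "\<lbrakk>x \<in> carrier S; y \<in> carrier S\<rbrakk> \<Longrightarrow> x \<oplus>\<^bsub>S\<^esub> y \<in> carrier S"
  by (simp add: add_S chi_add_def)

lemma g_add:
  assumes "x \<in> carrier S" "y \<in> carrier S"
  shows "g (x \<oplus>\<^bsub>S\<^esub> y) = g x \<oplus>\<^bsub>M\<^esub> g y"
  using assms
proof (cases rule: ghost_cases)
  case less
  then show ?thesis using assms add_S_eq_right by (simp add: bip_less_def bip_le_def)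
next
  case eq
  then show ?thesis using assms M.le_refl[of "g y"] by (simp add: add_S_eq_ghost bip_le_def)
next
  case greater
  then show ?thesis
    using assms add_S_eq_left by (simp add: bip_less_def bip_le_def M.a_comm[of "g x"])
qed

lemma add_S_comm: "\<lbrakk>x \<in> carrier S; y \<in> carrier S\<rbrakk> \<Longrightarrow> x \<oplus>\<^bsub>S\<^esub> y = y \<oplus>\<^bsub>S\<^esub> x"
  by (cases rule: ghost_cases[of x y]) (auto simp: add_S_eq_left add_S_eq_right add_S_eq_ghost)

lemma add_S_assoc:
  assumes "x \<in> carrier S" "y \<in> carrier S" "z \<in> carrier S"
  shows "(x \<oplus>\<^bsub>S\<^esub> y) \<oplus>\<^bsub>S\<^esub> z = x \<oplus>\<^bsub>S\<^esub> (y \<oplus>\<^bsub>S\<^esub> z)"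
proof -
  note less_trans = M.less_trans[of "g x" "g y" "g z"] M.less_trans[of "g z" "g y" "g x"]
  show ?thesis
    using assms(1,2)
  proof (cases rule: ghost_cases)
    case less
    show ?thesis using assms(2,3)
      by (cases rule: ghost_cases)
        (use assms less less_trans in \<open>auto simp: add_S_eq_left add_S_eq_right add_S_eq_ghost\<close>)
  next
    case eq
    show ?thesis using assms(2,3)
      by (cases rule: ghost_cases)
        (use assms eq in \<open>auto simp: add_S_eq_left add_S_eq_right add_S_eq_ghost\<close>)
  next
    case greater
    show ?thesis using assms(2,3)
      by (cases rule: ghost_cases)
        (use assms greater less_trans in \<open>auto simp: add_S_eq_left add_S_eq_right add_S_eq_ghost\<close>)
  qed
qed

lemma mult_S_comm: "\<lbrakk>x \<in> carrier S; y \<in> carrier S\<rbrakk> \<Longrightarrow> x \<otimes>\<^bsub>S\<^esub> y = y \<otimes>\<^bsub>S\<^esub> x"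
  by (cases x rule: S_cases; cases y rule: S_cases)
    (auto simp: mult_Inl_Inl mult_Inr R.m_comm M.m_comm)

lemma mult_S_assoc:
  "\<lbrakk>x \<in> carrier S; y \<in> carrier S; z \<in> carrier S\<rbrakk> \<Longrightarrow> (x \<otimes>\<^bsub>S\<^esub> y) \<otimes>\<^bsub>S\<^esub> z = x \<otimes>\<^bsub>S\<^esub> (y \<otimes>\<^bsub>S\<^esub> z)"
  by (cases x rule: S_cases; cases y rule: S_cases; cases z rule: S_cases)
    (auto simp: mult_Inl_Inl mult_Inr v_mult R.m_assoc M.m_assoc)

text \<open>
  Multiplication by \<open>x\<close> with \<open>g x \<noteq> 0\<close> preserves strict inequalities and ties between ghosts, so it
  preserves the case of the definition of addition.
\<close>

lemma mult_S_distrib: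
  assumes xyz: "x \<in> carrier S" "y \<in> carrier S" "z \<in> carrier S"
  shows "x \<otimes>\<^bsub>S\<^esub> (y \<oplus>\<^bsub>S\<^esub> z) = x \<otimes>\<^bsub>S\<^esub> y \<oplus>\<^bsub>S\<^esub> x \<otimes>\<^bsub>S\<^esub> z"
proof (cases "g x = \<zero>\<^bsub>M\<^esub>")
  case True
  then have "x = Inr \<zero>\<^bsub>M\<^esub>" using xyz g_eq_zero by blast
  then show ?thesis using xyz by (simp add: mult_Inr add_S_closed add_S_eq_ghost)
next
  case False
  note closed = mult_S_closed[OF xyz(1,2)] mult_S_closed[OF xyz(1,3)]
  show ?thesis using xyz(2,3)
  proof (cases rule: ghost_cases)
    case less
    then show ?thesis
      using xyz closed False mult_strict_mono[of "g y" "g z" "g x"]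
      by (simp add: add_S_eq_right g_mult)
  next
    case eq
    then show ?thesis using xyz by (simp add: add_S_eq_ghost mult_Inr g_mult)
  next
    case greater
    then show ?thesis
      using xyz closed False mult_strict_mono[of "g z" "g y" "g x"]
      by (simp add: add_S_eq_left g_mult)
  qed
qed

lemma one_mult_S: "x \<in> carrier S \<Longrightarrow> \<one>\<^bsub>S\<^esub> \<otimes>\<^bsub>S\<^esub> x = x"
  by (cases x rule: S_cases) (auto simp: one_S mult_Inl_Inl mult_Inr v_one)

lemma zero_add_S: "x \<in> carrier S \<Longrightarrow> \<zero>\<^bsub>S\<^esub> \<oplus>\<^bsub>S\<^esub> x = x"
  using g_eq_zero[of x]
  by (cases "g x = \<zero>\<^bsub>M\<^esub>") (auto simp: zero_S add_S_eq_ghost M.zero_less_iff add_S_eq_right)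

lemma csemiring_S: "csemiring S"
proof -
  have am: "abelian_monoid S"
    using add_S_closed add_S_assoc add_S_comm zero_add_S
    by (intro abelian_monoidI) (auto simp: zero_S)
  have cm: "comm_monoid S"
    using mult_S_closed mult_S_assoc mult_S_comm one_mult_S one_S_closed
    by (intro comm_monoidI) auto
  have "semiring_axioms S"
  proof (rule semiring_axioms.intro)
    fix x y z assume xyz: "x \<in> carrier S" "y \<in> carrier S" "z \<in> carrier S"
    show "z \<otimes>\<^bsub>S\<^esub> (x \<oplus>\<^bsub>S\<^esub> y) = z \<otimes>\<^bsub>S\<^esub> x \<oplus>\<^bsub>S\<^esub> z \<otimes>\<^bsub>S\<^esub> y"
      using xyz by (intro mult_S_distrib)
    then show "(x \<oplus>\<^bsub>S\<^esub> y) \<otimes>\<^bsub>S\<^esub> z = x \<otimes>\<^bsub>S\<^esub> z \<oplus>\<^bsub>S\<^esub> y \<otimes>\<^bsub>S\<^esub> z"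
      using xyz by (simp add: mult_S_comm[of _ z] add_S_closed)
  qed (auto simp: zero_S mult_Inr)
  then show ?thesis using am cm by (simp add: csemiring_def semiring_def comm_monoid.axioms)
qed

lemma supertropical_S: "supertropical S"
proof (intro supertropical.intro csemiring_S supertropical_axioms.intro)
  show "\<one>\<^bsub>S\<^esub> \<oplus>\<^bsub>S\<^esub> \<one>\<^bsub>S\<^esub> = \<one>\<^bsub>S\<^esub> \<oplus>\<^bsub>S\<^esub> \<one>\<^bsub>S\<^esub> \<oplus>\<^bsub>S\<^esub> \<one>\<^bsub>S\<^esub> \<oplus>\<^bsub>S\<^esub> \<one>\<^bsub>S\<^esub>"
    by (simp add: add_S_eq_ghost)
  fix x y assume xy: "x \<in> carrier S" "y \<in> carrier S"
  show "x \<oplus>\<^bsub>S\<^esub> y = x \<oplus>\<^bsub>S\<^esub> x" if "x \<oplus>\<^bsub>S\<^esub> x = y \<oplus>\<^bsub>S\<^esub> y"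
    using that by (simp add: add_S_eq_ghost)
  show "x \<oplus>\<^bsub>S\<^esub> y \<in> {x, y}" if "x \<oplus>\<^bsub>S\<^esub> x \<noteq> y \<oplus>\<^bsub>S\<^esub> y"
    using xy that
    by (cases rule: ghost_cases) (auto simp: add_S_eq_ghost add_S_eq_left add_S_eq_right[OF xy])
qed

lemma ghost_unit_S: "ghost_unit S = Inr \<one>\<^bsub>M\<^esub>"
  by (simp add: ghost_unit_def add_S_eq_ghost) (simp add: one_S v_one)

lemma carrier_ghosts_S: "carrier (ghosts S) = Inr ` carrier M"
proof -
  have "carrier (ghosts S) = (\<lambda>x. Inr (g x)) ` carrier S"
    by (simp add: ghosts_def ghost_unit_S mult_Inr)
  also have "\<dots> = Inr ` carrier M"
    by (auto simp: image_iff intro!: bexI[of _ "Inr _"])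
  finally show ?thesis .
qed

lemma add_Inr: "\<lbrakk>x \<in> carrier M; y \<in> carrier M\<rbrakk> \<Longrightarrow> Inr x \<oplus>\<^bsub>S\<^esub> Inr y = Inr (x \<oplus>\<^bsub>M\<^esub> y)"
  using g_add[of "Inr x" "Inr y"] by (auto simp: add_S chi_add_def split: if_splits)

lemma bip_le_ghosts_S:
  "\<lbrakk>x \<in> carrier M; y \<in> carrier M\<rbrakk> \<Longrightarrow> bip_le (ghosts S) (Inr x) (Inr y) \<longleftrightarrow> bip_le M x y"
  by (simp add: bip_le_def ghosts_def add_Inr)

lemma Inr_ring_iso: "Inr \<in> ring_iso M (ghosts S)"
proof (rule ring_iso_memI)
  show "bij_betw Inr (carrier M) (carrier (ghosts S))"
    by (auto simp: carrier_ghosts_S bij_betw_def)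
qed (auto simp: carrier_ghosts_S, auto simp: ghosts_def mult_Inr add_Inr ghost_unit_S)


section \<open>The supervaluation on classes\<close>

abbreviation \<chi> :: "'r \<Rightarrow> 'r set + 'm" where "\<chi> \<equiv> chi R M v"

lemma chi_zero: "\<lbrakk>a \<in> carrier R; v a = \<zero>\<^bsub>M\<^esub>\<rbrakk> \<Longrightarrow> \<chi> a = Inr \<zero>\<^bsub>M\<^esub>"
  and chi_nonzero: "v a \<noteq> \<zero>\<^bsub>M\<^esub> \<Longrightarrow> \<chi> a = Inl \<langle>a\<rangle>"
  by (simp_all add: chi_def val_kernel_def)

lemma chi_carrier: "a \<in> carrier R \<Longrightarrow> \<chi> a \<in> carrier S"
  by (cases "v a = \<zero>\<^bsub>M\<^esub>") (auto simp: chi_zero chi_nonzero Inl_in_S)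

lemma g_chi: "a \<in> carrier R \<Longrightarrow> g (\<chi> a) = v a"
  by (cases "v a = \<zero>\<^bsub>M\<^esub>") (auto simp: chi_zero chi_nonzero)

lemma ghost_of_chi: "a \<in> carrier R \<Longrightarrow> ghost_of S \<chi> a = Inr (v a)"
  by (simp add: ghost_of_def ghost_unit_S mult_Inr g_chi)

lemma chi_mult:
  assumes ab: "a \<in> carrier R" "b \<in> carrier R"
  shows "\<chi> (a \<otimes>\<^bsub>R\<^esub> b) = \<chi> a \<otimes>\<^bsub>S\<^esub> \<chi> b"
proof (cases "v a = \<zero>\<^bsub>M\<^esub> \<or> v b = \<zero>\<^bsub>M\<^esub>")
  case True
  then show ?thesis using ab by (auto simp: chi_zero v_mult mult_Inr g_chi)
next
  case False
  then show ?thesis using ab by (simp add: chi_nonzero v_mult mult_nonzero mult_Inl_Inl)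
qed

lemma supervaluation_chi: "supervaluation R S \<chi>"
proof (intro supervaluation.intro R.csemiring_axioms supertropical_S supervaluation_axioms.intro)
  show "\<chi> \<in> carrier R \<rightarrow> carrier S" using chi_carrier by blast
  show "\<chi> \<zero>\<^bsub>R\<^esub> = \<zero>\<^bsub>S\<^esub>" by (simp add: chi_zero v_zero zero_S)
  show "\<chi> \<one>\<^bsub>R\<^esub> = \<one>\<^bsub>S\<^esub>" by (simp add: chi_nonzero v_one one_nonzero one_S)
  fix a b assume ab: "a \<in> carrier R" "b \<in> carrier R"
  show "\<chi> (a \<otimes>\<^bsub>R\<^esub> b) = \<chi> a \<otimes>\<^bsub>S\<^esub> \<chi> b" using ab by (rule chi_mult)
  show "bip_le (ghosts S) (ghost_of S \<chi> (a \<oplus>\<^bsub>R\<^esub> b)) (ghost_of S \<chi> a \<oplus>\<^bsub>S\<^esub> ghost_of S \<chi> b)"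
    using ab v_add[OF ab] by (simp add: ghost_of_chi add_Inr bip_le_ghosts_S)
qed

lemma covers_chi: "covers R M v S \<chi>"
  unfolding covers_def using supervaluation_chi Inr_ring_iso ghost_of_chi by blast

lemma tangible_chi: "tangible R S \<chi>"
  unfolding tangible_def
proof (rule image_subsetI)
  fix a assume a: "a \<in> carrier R"
  show "\<chi> a \<in> tangibles S \<union> {\<zero>\<^bsub>S\<^esub>}"
    using chi_carrier[OF a] a
    by (cases "v a = \<zero>\<^bsub>M\<^esub>") (auto simp: chi_zero chi_nonzero zero_S tangibles_def carrier_ghosts_S)
qed

lemma chi_add_eq_left:
  assumes "a \<in> carrier R" "b \<in> carrier R" "bip_less M (v b) (v a)"
  shows "\<chi> (a \<oplus>\<^bsub>R\<^esub> b) = \<chi> a"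
  using assms M.less_imp_nonzero[of "v b" "v a"]
  by (simp add: chi_nonzero v_add_eq_left cls_add_eq_left)

lemma strong_chi: "strong R S \<chi>"
  unfolding strong_def
proof
  show "tangibly_additive R S \<chi>"
    unfolding tangibly_additive_def
  proof (intro ballI impI)
    fix a b assume ab: "a \<in> carrier R" "b \<in> carrier R" and tan: "\<chi> a \<oplus>\<^bsub>S\<^esub> \<chi> b \<in> tangibles S"
    show "\<chi> a \<oplus>\<^bsub>S\<^esub> \<chi> b = \<chi> (a \<oplus>\<^bsub>R\<^esub> b)"
      using chi_carrier[OF ab(1)] chi_carrier[OF ab(2)]
    proof (cases rule: ghost_cases)
      case less
      then show ?thesis
        using ab chi_add_eq_left[of b a] by (simp add: g_chi add_S_eq_right chi_carrier R.a_comm)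
    next
      case eq
      then show ?thesis using tan ab by (simp add: add_S_eq_ghost g_chi tangibles_def carrier_ghosts_S)
    next
      case greater
      then show ?thesis using ab chi_add_eq_left[of a b] by (simp add: g_chi add_S_eq_left)
    qed
  qed
  show "strong_map R (ghosts S) (ghost_of S \<chi>)"
    using strong by (auto simp: strong_map_def bip_max_def ghost_of_chi bip_le_ghosts_S)
qed


section \<open>Dominance\<close>

text \<open>
  The relation \<open>val_rel\<close> identifies only what a very strong cover \<open>\<psi>\<close> is forced to identify: \<open>\<psi>\<close> absorbs
  summands of smaller value and vanishes where \<open>v\<close> does.
\<close>

lemma chi_dominates:
  fixes V :: "('u, 'z) ring_scheme"
  assumes cov: "covers R M v V \<psi>" and vs: "very_strong R V \<psi>"
  shows "dominates R S \<chi> V \<psi>"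
proof -
  from cov have sv: "supervaluation R V \<psi>" unfolding covers_def by blast
  from cov obtain \<iota> where iso: "\<iota> \<in> ring_iso M (ghosts V)"
    and \<iota>: "\<And>a. a \<in> carrier R \<Longrightarrow> ghost_of V \<psi> a = \<iota> (v a)" unfolding covers_def by blast
  interpret V: supervaluation R V \<psi> by (rule sv)
  have le: "bip_le (ghosts V) (ghost_of V \<psi> a) (ghost_of V \<psi> b)"
    if "a \<in> carrier R" "b \<in> carrier R" "bip_le M (v a) (v b)" for a b
    using that ring_iso_memE(3)[OF iso, of "v a" "v b"] by (simp add: bip_le_def \<iota>)
  have inj: "inj_on \<iota> (carrier M)"
    using ring_iso_memE(5)[OF iso] by (rule bij_betw_imp_inj_on)
  have absorb: "\<psi> (a \<oplus>\<^bsub>R\<^esub> c) = \<psi> a"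
    if ac: "a \<in> carrier R" "c \<in> carrier R" and less: "bip_less M (v c) (v a)" for a c
  proof -
    have "bip_less (ghosts V) (ghost_of V \<psi> c) (ghost_of V \<psi> a)"
      using ac less le[of c a] inj_onD[OF inj, of "v c" "v a"] by (auto simp: bip_less_def \<iota>)
    then have "\<psi> (c \<oplus>\<^bsub>R\<^esub> a) = \<psi> a" using vs ac unfolding very_strong_def by blast
    then show ?thesis using ac by (simp add: R.a_comm)
  qed
  have vanish: "\<psi> a = \<zero>\<^bsub>V\<^esub>" if a: "a \<in> carrier R" "v a = \<zero>\<^bsub>M\<^esub>" for a
  proof -
    have "ghost_of V \<psi> a = ghost_of V \<psi> \<zero>\<^bsub>R\<^esub>" using a by (simp add: \<iota> v_zero)
    also have "\<dots> = \<zero>\<^bsub>V\<^esub>" using V.U.ghost_unit_closed by (simp add: ghost_of_def V.map_zero)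
    finally show ?thesis using a V.closed V.U.ghost_eq_zero by (auto simp: ghost_of_def)
  qed
  have rel_imp_eq: "\<psi> a = \<psi> b" if ab: "a \<sim> b" for a b
    using ab
  proof (cases rule: rel_cases)
    case zero
    then show ?thesis using rel_carrier[OF ab] by (simp add: vanish)
  next
    case (sum c d)
    then show ?thesis using absorb rel_carrier[OF ab] by metis
  qed
  have zero_ghost: "\<zero>\<^bsub>V\<^esub> \<in> carrier (ghosts V)"
    using V.U.ghost_unit_closed by (auto simp: ghosts_def intro!: image_eqI[of _ _ "\<zero>\<^bsub>V\<^esub>"])
  show ?thesis
    unfolding dominates_def
  proof (intro ballI conjI impI)
    fix a b assume ab: "a \<in> carrier R" "b \<in> carrier R"
    show "\<psi> a = \<psi> b" if eq: "\<chi> a = \<chi> b"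
    proof (rule rel_imp_eq, cases "v a = \<zero>\<^bsub>M\<^esub>")
      case True
      then show "a \<sim> b" using g_chi ab eq by (metis rel_zeroI)
    next
      case False
      then have "v b \<noteq> \<zero>\<^bsub>M\<^esub>" using g_chi ab eq by metis
      then show "a \<sim> b" using False eq ab by (simp add: chi_nonzero cls_eq_iff)
    qed
    show "bip_le (ghosts V) (ghost_of V \<psi> a) (ghost_of V \<psi> b)"
      if "bip_le (ghosts S) (ghost_of S \<chi> a) (ghost_of S \<chi> b)"
      using that ab by (intro le) (simp_all add: ghost_of_chi bip_le_ghosts_S)
    show "\<psi> a \<in> carrier (ghosts V)" if "\<chi> a \<in> carrier (ghosts S)"
    proof -
      have "v a = \<zero>\<^bsub>M\<^esub>" using that by (cases "v a = \<zero>\<^bsub>M\<^esub>") (auto simp: carrier_ghosts_S chi_nonzero)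
      then show ?thesis using ab vanish zero_ghost by simp
    qed
  qed
qed

lemma chi_in_Covers: "(S, \<chi>) \<in> Covers R M v"
  using covers_chi by (simp add: Covers_def)

text \<open>
  Stated for a property \<open>P\<close> of supervaluations, since the two parts of the poset differ only in the
  property that selects them. Dominance can be checked on a representative with property \<open>P\<close>, as the
  order of classes does not depend on representatives.
\<close>

lemma greatest_class_chi:
  assumes P: "P S \<chi>" and very_strong: "\<And>U \<phi>. \<lbrakk>covers R M v U \<phi>; P U \<phi>\<rbrakk> \<Longrightarrow> very_strong R U \<phi>"
  shows "greatest (Cov R M v) (cover_class R M v S \<chi>)
    {C \<in> carrier (Cov R M v). \<exists>(U, \<phi>)\<in>C. P U \<phi>}" (is "greatest _ ?T ?S")
proof -
  have "?T \<in> carrier (Cov R M v)"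
    using quotientI[OF chi_in_Covers] by (simp add: Cov_def cover_class_def)
  moreover have "(S, \<chi>) \<in> ?T"
    using equiv_class_self[OF equiv_cover_equiv chi_in_Covers] by (simp add: cover_class_def)
  moreover have "class_le R C ?T" if C: "C \<in> ?S" for C
  proof -
    obtain U \<phi> where U: "(U, \<phi>) \<in> C" "P U \<phi>" using C by blast
    have CQ: "C \<in> Covers R M v // cover_equiv R M v" using C by (simp add: Cov_def)
    have UC: "(U, \<phi>) \<in> Covers R M v"
      using in_quotient_imp_subset[OF equiv_cover_equiv CQ] U(1) by blast
    have "C = cover_class R M v U \<phi>"
      using CQ U(1) equiv_class_eq_iff[OF equiv_cover_equiv] equiv_cover_equiv
      unfolding cover_class_def by (metis (no_types) Image_singleton_iff equiv_class_eq quotientE)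
    moreover have "dominates R S \<chi> U \<phi>"
      using UC U(2) very_strong chi_dominates unfolding Covers_def by blast
    ultimately show ?thesis using class_le_class_iff[OF UC chi_in_Covers] by simp
  qed
  ultimately show ?thesis using P unfolding greatest_def by (auto simp: Cov_def)
qed

end


section \<open>The largest very strong cover\<close>

theorem theorem10p8:
  fixes R :: "('r, 'x) ring_scheme" and M :: "('m, 'y) ring_scheme" and v :: "'r \<Rightarrow> 'm"
  assumes "strong_valuation R M v"
  shows "(\<forall>(V :: ('u, 'z) ring_scheme) \<psi>. covers R M v V \<psi> \<and> very_strong R V \<psi> \<longrightarrow>
            dominates R (chi_semiring R M v) (chi R M v) V \<psi>) \<and>
         greatest (Cov R M v) (cover_class R M v (chi_semiring R M v) (chi R M v))
           (Cov_very_strong R M v) \<and>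
         greatest (Cov R M v) (cover_class R M v (chi_semiring R M v) (chi R M v))
           (Cov_tangible_strong R M v)"
proof -
  interpret strongly_valued R M v
    using assms by (simp add: strong_valuation_def strongly_valued_def strongly_valued_axioms_def)
  have very_strong_chi: "very_strong R S \<chi>"
    using supervaluation_chi tangible_chi strong_chi by (rule tangible_strong_imp_very_strong)
  show ?thesis
    unfolding Cov_very_strong_def Cov_tangible_strong_def
  proof (intro conjI allI impI)
    show "dominates R S \<chi> V \<psi>" if "covers R M v V \<psi> \<and> very_strong R V \<psi>"
      for V :: "('u, 'z) ring_scheme" and \<psi>
      using that chi_dominates by blast
  next
    show "greatest (Cov R M v) (cover_class R M v S \<chi>)
      {C \<in> carrier (Cov R M v). \<exists>(U, \<phi>)\<in>C. very_strong R U \<phi>}"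
      using very_strong_chi by (rule greatest_class_chi)
  next
    show "greatest (Cov R M v) (cover_class R M v S \<chi>)
      {C \<in> carrier (Cov R M v). \<exists>(U, \<phi>)\<in>C. tangible R U \<phi> \<and> strong R U \<phi>}"
      using tangible_chi strong_chi
      by (intro greatest_class_chi)
        (auto simp: covers_def intro: tangible_strong_imp_very_strong)
  qed
qed

end
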